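(* Let $R$ be a commutative ring and $M$ a nonzero $R$-module with two minimal second representations $\sum_{i=1}^nK_i=M=\sum_{j=1}^mN_j$, where $K_i$ is $p_i$-second for all $i\in\{1,\dots,n\}$ and $N_j$ is $q_j$-second for all $j\in\{1,\dots,m\}$. Then $\{p_1,p_2,\dots,p_n\}=\{q_1,q_2,\dots,q_m\}$.
   Context: Let $R$ be a commutative ring and $M$ a nonzero $R$-module. A submodule $K\le M$ is called second if $K\neq 0$ and for every ideal $I\le R$ we have $IK=K$ or $IK=0$. If $K$ is second, then $p:=(0:_RK)=\{r\in R\mid rK=0\}$ is a prime ideal and $K$ is called $p$-second. A second representation of $M$ is an expression $M=\sum_{i=1}^nK_i$ as a finite sum of second submodules. It is called minimal if (1) $(0:_RK_i)\neq(0:_RK_j)$ for $i\neq j$, and (2) $K_j\nsubseteq\sum_{i\neq j}K_i$ for all $j=1,\dots,n$. *)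

theory Defs
  imports "HOL-Algebra.Algebra"
begin

text \<open>
  Submodules are the library's \<open>submodule\<close> (a carrier set); commutative rings are \<open>cring\<close>,
  which is part of the locale \<open>module\<close>.
\<close>

definition annihilator :: "('a, 'r) ring_scheme \<Rightarrow> ('a, 'b, 'm) module_scheme \<Rightarrow> 'b set \<Rightarrow> 'a set"
  where "annihilator R M K = {r \<in> carrier R. \<forall>x\<in>K. r \<odot>\<^bsub>M\<^esub> x = \<zero>\<^bsub>M\<^esub>}"

text \<open>
  \<open>ideal_smult M I K\<close> is \<open>IK\<close>, the set of all finite sums of products \<open>a x\<close> with
  \<open>a \<in> I\<close>, \<open>x \<in> K\<close>.  As \<open>I\<close> is closed under negation, this is the additive subgroup
  generated by the products.
\<close>

definition ideal_smult :: "('a, 'b, 'm) module_scheme \<Rightarrow> 'a set \<Rightarrow> 'b set \<Rightarrow> 'b set"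
  where "ideal_smult M I K = generate (add_monoid M) {a \<odot>\<^bsub>M\<^esub> x | a x. a \<in> I \<and> x \<in> K}"

definition second_submodule ::
    "('a, 'r) ring_scheme \<Rightarrow> ('a, 'b, 'm) module_scheme \<Rightarrow> 'b set \<Rightarrow> bool"
  where "second_submodule R M K \<longleftrightarrow>
    submodule K R M \<and> K \<noteq> {\<zero>\<^bsub>M\<^esub>} \<and>
    (\<forall>I. ideal I R \<longrightarrow> ideal_smult M I K = K \<or> ideal_smult M I K = {\<zero>\<^bsub>M\<^esub>})"

text \<open>
  Primality of \<open>p\<close> is not demanded, since it follows; see \<open>p_second_imp_primeideal\<close> below.
\<close>

definition p_second ::
    "('a, 'r) ring_scheme \<Rightarrow> ('a, 'b, 'm) module_scheme \<Rightarrow> 'a set \<Rightarrow> 'b set \<Rightarrow> bool"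
  where "p_second R M p K \<longleftrightarrow> second_submodule R M K \<and> p = annihilator R M K"

definition submodule_sum ::
    "('a, 'b, 'm) module_scheme \<Rightarrow> nat set \<Rightarrow> (nat \<Rightarrow> 'b set) \<Rightarrow> 'b set"
  where "submodule_sum M A K = {\<Oplus>\<^bsub>M\<^esub>i\<in>A. x i | x. \<forall>i\<in>A. x i \<in> K i}"

text \<open>
  The summands are indexed by \<open>{1..n}\<close>; values of \<open>K\<close> outside this range are irrelevant.
\<close>

definition second_representation ::
    "('a, 'r) ring_scheme \<Rightarrow> ('a, 'b, 'm) module_scheme \<Rightarrow> nat \<Rightarrow> (nat \<Rightarrow> 'b set) \<Rightarrow> bool"
  where "second_representation R M n K \<longleftrightarrow>
    (\<forall>i\<in>{1..n}. second_submodule R M (K i)) \<and> carrier M = submodule_sum M {1..n} K"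

definition minimal_second_representation ::
    "('a, 'r) ring_scheme \<Rightarrow> ('a, 'b, 'm) module_scheme \<Rightarrow> nat \<Rightarrow> (nat \<Rightarrow> 'b set) \<Rightarrow> bool"
  where "minimal_second_representation R M n K \<longleftrightarrow>
    second_representation R M n K \<and>
    (\<forall>i\<in>{1..n}. \<forall>j\<in>{1..n}. i \<noteq> j \<longrightarrow> annihilator R M (K i) \<noteq> annihilator R M (K j)) \<and>
    (\<forall>j\<in>{1..n}. \<not> K j \<subseteq> submodule_sum M ({1..n} - {j}) K)"

lemma (in module) annihilator_ideal:
  assumes "submodule K R M"
  shows "ideal (annihilator R M K) R"
proof -
  have K: "K \<subseteq> carrier M" using submoduleE(1)[OF assms] .
  have "subgroup (annihilator R M K) (add_monoid R)"
  proof (rule R.add.subgroupI)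
    show "annihilator R M K \<noteq> {}"
      using K unfolding annihilator_def by (auto intro!: exI[of _ \<zero>])
  next
    fix a assume "a \<in> annihilator R M K"
    then show "\<ominus> a \<in> annihilator R M K"
      using K unfolding annihilator_def by (auto simp: smult_l_minus subset_iff)
  next
    fix a b assume "a \<in> annihilator R M K" "b \<in> annihilator R M K"
    then show "a \<oplus> b \<in> annihilator R M K"
      using K unfolding annihilator_def by (auto simp: smult_l_distr subset_iff)
  qed (auto simp: annihilator_def)
  moreover have "x \<otimes> a \<in> annihilator R M K"
    if "a \<in> annihilator R M K" "x \<in> carrier R" for a x
    using that K unfolding annihilator_def by (auto simp: smult_assoc1 subset_iff)
  moreover from this have "a \<otimes> x \<in> annihilator R M K"
    if "a \<in> annihilator R M K" "x \<in> carrier R" for a x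
    using that R.m_comm[of a x] by (auto simp: annihilator_def)
  ultimately show ?thesis
    using R.ring_axioms by (intro idealI)
qed

lemma (in module) p_second_imp_primeideal:
  assumes "p_second R M p K"
  shows "primeideal p R"
proof -
  have p: "p = annihilator R M K" and sub: "submodule K R M" and nz: "K \<noteq> {\<zero>\<^bsub>M\<^esub>}"
    and sec: "\<And>I. ideal I R \<Longrightarrow> ideal_smult M I K = K \<or> ideal_smult M I K = {\<zero>\<^bsub>M\<^esub>}"
    using assms unfolding p_second_def second_submodule_def by auto
  have K: "K \<subseteq> carrier M" using submoduleE(1)[OF sub] .
  have ne: "carrier R \<noteq> p"
  proof
    assume "carrier R = p"
    then have "\<forall>x\<in>K. \<one> \<odot>\<^bsub>M\<^esub> x = \<zero>\<^bsub>M\<^esub>"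
      using R.one_closed unfolding p annihilator_def by blast
    then have "K \<subseteq> {\<zero>\<^bsub>M\<^esub>}" using K by (metis smult_one singletonI subset_iff)
    then show False using nz submoduleE(2)[OF sub] by blast
  qed
  have "a \<in> p \<or> b \<in> p" if a: "a \<in> carrier R" and b: "b \<in> carrier R" and ab: "a \<otimes> b \<in> p" for a b
  proof (rule disjCI)
    assume "b \<notin> p"
    then obtain y where y: "y \<in> K" "b \<odot>\<^bsub>M\<^esub> y \<noteq> \<zero>\<^bsub>M\<^esub>"
      using b unfolding p annihilator_def by auto
    have "b \<odot>\<^bsub>M\<^esub> y \<in> ideal_smult M (PIdl b) K"
      unfolding ideal_smult_def using y(1) R.cgenideal_self[OF b] by (auto intro: generate.incl)
    then have eq: "ideal_smult M (PIdl b) K = K"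
      using sec[OF R.cgenideal_ideal[OF b]] y(2) by auto
    have z: "x \<in> carrier M \<and> a \<odot>\<^bsub>M\<^esub> x = \<zero>\<^bsub>M\<^esub>" if "x \<in> ideal_smult M (PIdl b) K" for x
    proof -
      have base: "h \<in> carrier M \<and> a \<odot>\<^bsub>M\<^esub> h = \<zero>\<^bsub>M\<^esub>"
        if gen: "h \<in> {c \<odot>\<^bsub>M\<^esub> x | c x. c \<in> PIdl b \<and> x \<in> K}" for h
      proof -
        obtain r u where h: "h = (r \<otimes> b) \<odot>\<^bsub>M\<^esub> u" "r \<in> carrier R" "u \<in> K"
          using gen unfolding cgenideal_def by auto
        have u: "u \<in> carrier M" using h(3) K by auto
        have "a \<odot>\<^bsub>M\<^esub> h = (a \<otimes> (r \<otimes> b)) \<odot>\<^bsub>M\<^esub> u"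
          unfolding h(1) using a b h(2) u by (simp add: smult_assoc1)
        also have "a \<otimes> (r \<otimes> b) = r \<otimes> (a \<otimes> b)"
          using a b h(2) by (simp add: R.m_lcomm)
        also have "(r \<otimes> (a \<otimes> b)) \<odot>\<^bsub>M\<^esub> u = r \<odot>\<^bsub>M\<^esub> ((a \<otimes> b) \<odot>\<^bsub>M\<^esub> u)"
          using a b h(2) u by (intro smult_assoc1) auto
        also have "(a \<otimes> b) \<odot>\<^bsub>M\<^esub> u = \<zero>\<^bsub>M\<^esub>"
          using ab h(3) unfolding p annihilator_def by auto
        finally show ?thesis using h u b by simp
      qed
      show ?thesis
        using that unfolding ideal_smult_def
      proof (induct rule: generate.induct)
        case one then show ?case using a by simp
      next
        case (incl h) then show ?case using base by blast
      next
        case (inv h)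
        have hM: "h \<in> carrier M" and h0: "a \<odot>\<^bsub>M\<^esub> h = \<zero>\<^bsub>M\<^esub>" using base[OF inv] by auto
        have "a \<odot>\<^bsub>M\<^esub> (\<ominus>\<^bsub>M\<^esub> h) = \<zero>\<^bsub>M\<^esub>"
          using smult_r_minus[OF a hM] h0 by simp
        then show ?case using hM by (simp add: a_inv_def[symmetric])
      next
        case (eng h1 h2) then show ?case using a by (simp add: smult_r_distr)
      qed
    qed
    show "a \<in> p" using a z eq unfolding p annihilator_def by auto
  qed
  then show ?thesis
    using annihilator_ideal[OF sub] ne R.cring_axioms p by (intro primeidealI) auto
qed

end

theory Submission
  imports Defs
begin

text \<open>
  For a submodule \<open>Q\<close> consider the colon ideal \<open>(Q : M) = {r. rM \<subseteq> Q}\<close>.  If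
  \<open>K\<close> is second and \<open>r\<close> does not annihilate \<open>K\<close>, then multiplication by \<open>r\<close> maps \<open>K\<close> onto
  itself; hence \<open>(Q : K)\<close> is the whole ring when \<open>K \<subseteq> Q\<close> and is the annihilator of \<open>K\<close> otherwise.
  Consequently, for a second representation \<open>M = \<Sum> K\<^sub>i\<close>, the ideal \<open>(Q : M)\<close> is the intersection
  of the annihilators of those \<open>K\<^sub>i\<close> that do not lie in \<open>Q\<close>
  (\<open>colon_carrier_second_representation\<close>).

  The colon ideal does not depend on the representation, so it can be computed with both.
  Take \<open>Q = \<Sum>\<^sub>l\<^sub>\<noteq>\<^sub>j N\<^sub>l\<close>.  By irredundancy, \<open>N\<^sub>j\<close> is the only summand
  of the second representation outside \<open>Q\<close>, so \<open>(Q : M) = q\<^sub>j\<close>.  The first representation expresses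
  the same ideal as a finite intersection of some of the \<open>p\<^sub>i\<close>.  As \<open>q\<^sub>j\<close> is prime, it contains one
  of these \<open>p\<^sub>i\<close>, and being their intersection it equals that \<open>p\<^sub>i\<close>.  Exchanging the two
  representations gives the other inclusion.
\<close>

section \<open>Prime ideals and finite intersections\<close>

text \<open>
  The factor \<open>carrier R\<close> makes the intersection over an empty index set the whole ring, which a
  prime ideal never contains.
\<close>

lemma (in primeideal) finite_Inter_subset_imp_subset:
  assumes "finite A" and "\<And>i. i \<in> A \<Longrightarrow> ideal (J i) R"
    and "carrier R \<inter> (\<Inter>i\<in>A. J i) \<subseteq> I"
  shows "\<exists>i\<in>A. J i \<subseteq> I"
  using assms
proof (induction A rule: finite_induct)
  case empty
  then show ?case using a_subset I_notcarr by auto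
next
  case (insert k A)
  show ?case
  proof (rule ccontr)
    assume neg: "\<not> ?case"
    then obtain a where a: "a \<in> J k" "a \<notin> I" by auto
    from neg insert have "\<not> carrier R \<inter> (\<Inter>i\<in>A. J i) \<subseteq> I" by auto
    then obtain b where b: "b \<in> carrier R" "\<And>i. i \<in> A \<Longrightarrow> b \<in> J i" "b \<notin> I" by auto
    have id: "ideal (J i) R" if "i \<in> insert k A" for i
      using insert.prems(1) that .
    have aR: "a \<in> carrier R"
      using ideal.Icarr[OF id] a(1) by blast
    have "a \<otimes> b \<in> J k"
      using ideal.I_r_closed[OF id] a(1) b(1) by blast
    moreover have "a \<otimes> b \<in> J i" if "i \<in> A" for i
      using ideal.I_l_closed[OF id] b(2)[OF that] aR that by blast
    ultimately have "a \<otimes> b \<in> I"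
      using insert.prems(2) aR b(1) by auto
    with I_prime[OF aR b(1)] a(2) b(3) show False by blast
  qed
qed

section \<open>Sums of submodules and colon ideals\<close>

definition colon ::
    "('a, 'r) ring_scheme \<Rightarrow> ('a, 'b, 'm) module_scheme \<Rightarrow> 'b set \<Rightarrow> 'b set \<Rightarrow> 'a set"
  where "colon R M Q K = {r \<in> carrier R. \<forall>x\<in>K. r \<odot>\<^bsub>M\<^esub> x \<in> Q}"

context module
begin

lemma zero_in_submodule: "submodule Q R M \<Longrightarrow> \<zero>\<^bsub>M\<^esub> \<in> Q"
  using subgroup.one_closed[OF submodule.axioms(1)] by fastforce

lemma finsum_in_submodule:
  assumes Q: "submodule Q R M" and "\<And>i. i \<in> A \<Longrightarrow> x i \<in> Q"
  shows "(\<Oplus>\<^bsub>M\<^esub>i\<in>A. x i) \<in> Q"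
  using assms(2)
proof (induction A rule: infinite_finite_induct)
  case (infinite A)
  then show ?case using zero_in_submodule[OF Q] by simp
next
  case empty
  then show ?case using zero_in_submodule[OF Q] by simp
next
  case (insert k A)
  have "(\<Oplus>\<^bsub>M\<^esub>i\<in>insert k A. x i) = x k \<oplus>\<^bsub>M\<^esub> (\<Oplus>\<^bsub>M\<^esub>i\<in>A. x i)"
    using insert submoduleE(1)[OF Q] by (intro M.finsum_insert) auto
  then show ?case using insert submoduleE(5)[OF Q] by auto
qed

lemma submodule_submodule_sum:
  assumes "finite A" and K: "\<And>i. i \<in> A \<Longrightarrow> submodule (K i) R M"
  shows "submodule (submodule_sum M A K) R M"
proof -
  have c: "x \<in> A \<rightarrow> carrier M" if "\<forall>i\<in>A. x i \<in> K i" for x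
    using that submoduleE(1)[OF K] by blast
  have smult: "a \<odot>\<^bsub>M\<^esub> u \<in> submodule_sum M A K"
    if "a \<in> carrier R" "u \<in> submodule_sum M A K" for a u
  proof -
    obtain x where x: "\<forall>i\<in>A. x i \<in> K i" "u = (\<Oplus>\<^bsub>M\<^esub>i\<in>A. x i)"
      using \<open>u \<in> _\<close> unfolding submodule_sum_def by auto
    have "a \<odot>\<^bsub>M\<^esub> u = (\<Oplus>\<^bsub>M\<^esub>i\<in>A. a \<odot>\<^bsub>M\<^esub> x i)"
      unfolding x(2) using that(1) c[OF x(1)] assms(1) by (intro finsum_smult_ldistr) auto
    moreover have "\<forall>i\<in>A. a \<odot>\<^bsub>M\<^esub> x i \<in> K i"
      using x(1) that(1) submoduleE(4)[OF K] by blast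
    ultimately show ?thesis unfolding submodule_sum_def by auto
  qed
  have sub: "submodule_sum M A K \<subseteq> carrier M"
    unfolding submodule_sum_def using c by (auto intro!: M.finsum_closed)
  show ?thesis
  proof (rule submoduleI)
    show "submodule_sum M A K \<subseteq> carrier M" by fact
    have "\<forall>i\<in>A. \<zero>\<^bsub>M\<^esub> \<in> K i"
      using zero_in_submodule[OF K] by simp
    moreover have "\<zero>\<^bsub>M\<^esub> = (\<Oplus>\<^bsub>M\<^esub>i\<in>A. \<zero>\<^bsub>M\<^esub>)" by simp
    ultimately show "\<zero>\<^bsub>M\<^esub> \<in> submodule_sum M A K"
      unfolding submodule_sum_def by blast
  next
    fix u assume u: "u \<in> submodule_sum M A K"
    then have "\<ominus>\<^bsub>M\<^esub> u = (\<ominus> \<one>) \<odot>\<^bsub>M\<^esub> u"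
      using sub by (simp add: smult_l_minus subset_iff)
    then show "\<ominus>\<^bsub>M\<^esub> u \<in> submodule_sum M A K" using smult u by simp
  next
    fix u v assume "u \<in> submodule_sum M A K" "v \<in> submodule_sum M A K"
    then obtain x y where x: "\<forall>i\<in>A. x i \<in> K i" "u = (\<Oplus>\<^bsub>M\<^esub>i\<in>A. x i)"
      and y: "\<forall>i\<in>A. y i \<in> K i" "v = (\<Oplus>\<^bsub>M\<^esub>i\<in>A. y i)"
      unfolding submodule_sum_def by auto
    have "u \<oplus>\<^bsub>M\<^esub> v = (\<Oplus>\<^bsub>M\<^esub>i\<in>A. x i \<oplus>\<^bsub>M\<^esub> y i)"
      unfolding x(2) y(2) using c[OF x(1)] c[OF y(1)] by (simp add: M.finsum_addf)
    moreover have "\<forall>i\<in>A. x i \<oplus>\<^bsub>M\<^esub> y i \<in> K i"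
      using x(1) y(1) submoduleE(5)[OF K] by blast
    ultimately show "u \<oplus>\<^bsub>M\<^esub> v \<in> submodule_sum M A K"
      unfolding submodule_sum_def by auto
  qed (use smult in auto)
qed

lemma summand_subset_submodule_sum:
  assumes "finite A" and K: "\<And>i. i \<in> A \<Longrightarrow> submodule (K i) R M" and j: "j \<in> A"
  shows "K j \<subseteq> submodule_sum M A K"
proof
  fix y assume y: "y \<in> K j"
  let ?x = "\<lambda>i. if j = i then y else \<zero>\<^bsub>M\<^esub>"
  have "y \<in> carrier M" using y submoduleE(1)[OF K[OF j]] by blast
  then have sum: "(\<Oplus>\<^bsub>M\<^esub>i\<in>A. ?x i) = y"
    using M.add.finprod_singleton[of j A "\<lambda>_. y"] assms(1) j by simp
  have "\<forall>i\<in>A. ?x i \<in> K i"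
    using y zero_in_submodule[OF K] by simp
  then show "y \<in> submodule_sum M A K"
    unfolding submodule_sum_def using sum[symmetric] by (intro CollectI exI[of _ ?x] conjI)
qed

lemma colon_submodule_sum:
  assumes "finite A" and K: "\<And>i. i \<in> A \<Longrightarrow> submodule (K i) R M" and Q: "submodule Q R M"
  shows "colon R M Q (submodule_sum M A K) = carrier R \<inter> (\<Inter>i\<in>A. colon R M Q (K i))"
proof (intro equalityI subsetI)
  fix r assume r: "r \<in> colon R M Q (submodule_sum M A K)"
  have "K i \<subseteq> submodule_sum M A K" if "i \<in> A" for i
    by (rule summand_subset_submodule_sum[where K = K]) (use assms(1) K that in auto)
  then show "r \<in> carrier R \<inter> (\<Inter>i\<in>A. colon R M Q (K i))"
    using r unfolding colon_def by fast
next
  fix r assume r: "r \<in> carrier R \<inter> (\<Inter>i\<in>A. colon R M Q (K i))"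
  have "r \<odot>\<^bsub>M\<^esub> (\<Oplus>\<^bsub>M\<^esub>i\<in>A. x i) \<in> Q" if x: "\<forall>i\<in>A. x i \<in> K i" for x
  proof -
    have "x \<in> A \<rightarrow> carrier M" using x submoduleE(1)[OF K] by blast
    then have "r \<odot>\<^bsub>M\<^esub> (\<Oplus>\<^bsub>M\<^esub>i\<in>A. x i) = (\<Oplus>\<^bsub>M\<^esub>i\<in>A. r \<odot>\<^bsub>M\<^esub> x i)"
      using r assms(1) by (intro finsum_smult_ldistr) auto
    also have "\<dots> \<in> Q"
      using r x by (intro finsum_in_submodule[OF Q]) (auto simp: colon_def)
    finally show ?thesis .
  qed
  then show "r \<in> colon R M Q (submodule_sum M A K)"
    using r unfolding colon_def submodule_sum_def by auto
qed

section \<open>Colon ideals of second submodules\<close>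

text \<open>
  Secondness speaks of ideals; for a single ring element \<open>r\<close> it is applied to the principal ideal
  of \<open>r\<close>, using that \<open>(r)K\<close> consists of the multiples \<open>r y\<close> with \<open>y \<in> K\<close>.
\<close>

lemma second_submodule_smult_surj:
  assumes sec: "second_submodule R M K" and r: "r \<in> carrier R" "r \<notin> annihilator R M K"
  shows "K \<subseteq> (\<lambda>y. r \<odot>\<^bsub>M\<^esub> y) ` K"
proof -
  have sub: "submodule K R M" using sec unfolding second_submodule_def by simp
  have K: "K \<subseteq> carrier M" using submoduleE(1)[OF sub] .
  let ?G = "{a \<odot>\<^bsub>M\<^esub> x | a x. a \<in> PIdl r \<and> x \<in> K}"
  obtain y where y: "y \<in> K" "r \<odot>\<^bsub>M\<^esub> y \<noteq> \<zero>\<^bsub>M\<^esub>"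
    using r unfolding annihilator_def by auto
  have "r \<odot>\<^bsub>M\<^esub> y \<in> ideal_smult M (PIdl r) K"
    unfolding ideal_smult_def using y(1) R.cgenideal_self[OF r(1)] by (auto intro: generate.incl)
  then have eq: "ideal_smult M (PIdl r) K = K"
    using sec R.cgenideal_ideal[OF r(1)] y(2) unfolding second_submodule_def by blast
  have "?G \<subseteq> (\<lambda>y. r \<odot>\<^bsub>M\<^esub> y) ` K"
  proof
    fix g assume "g \<in> ?G"
    then obtain s x where g: "g = (s \<otimes> r) \<odot>\<^bsub>M\<^esub> x" "s \<in> carrier R" "x \<in> K"
      unfolding cgenideal_def by auto
    then have "g = r \<odot>\<^bsub>M\<^esub> (s \<odot>\<^bsub>M\<^esub> x)"
      using r(1) K R.m_comm[of s r] by (auto simp: smult_assoc1 subset_iff)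
    then show "g \<in> (\<lambda>y. r \<odot>\<^bsub>M\<^esub> y) ` K" using g submoduleE(4)[OF sub] by blast
  qed
  moreover have "subgroup ((\<lambda>y. r \<odot>\<^bsub>M\<^esub> y) ` K) (add_monoid M)"
  proof (rule M.add.subgroupI)
    show "(\<lambda>y. r \<odot>\<^bsub>M\<^esub> y) ` K \<subseteq> carrier M" using K r(1) by auto
    show "(\<lambda>y. r \<odot>\<^bsub>M\<^esub> y) ` K \<noteq> {}" using y(1) by blast
  next
    fix u assume "u \<in> (\<lambda>y. r \<odot>\<^bsub>M\<^esub> y) ` K"
    then obtain x where x: "x \<in> K" "u = r \<odot>\<^bsub>M\<^esub> x" by auto
    then have "\<ominus>\<^bsub>M\<^esub> u = r \<odot>\<^bsub>M\<^esub> (\<ominus>\<^bsub>M\<^esub> x)"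
      using smult_r_minus r(1) K by auto
    then show "\<ominus>\<^bsub>M\<^esub> u \<in> (\<lambda>y. r \<odot>\<^bsub>M\<^esub> y) ` K"
      using submoduleE(3)[OF sub] x by blast
  next
    fix u v assume "u \<in> (\<lambda>y. r \<odot>\<^bsub>M\<^esub> y) ` K" "v \<in> (\<lambda>y. r \<odot>\<^bsub>M\<^esub> y) ` K"
    then obtain x z where x: "x \<in> K" "u = r \<odot>\<^bsub>M\<^esub> x" "z \<in> K" "v = r \<odot>\<^bsub>M\<^esub> z" by auto
    then have "u \<oplus>\<^bsub>M\<^esub> v = r \<odot>\<^bsub>M\<^esub> (x \<oplus>\<^bsub>M\<^esub> z)"
      using smult_r_distr r(1) K by (auto simp: subset_iff)
    then show "u \<oplus>\<^bsub>M\<^esub> v \<in> (\<lambda>y. r \<odot>\<^bsub>M\<^esub> y) ` K"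
      using submoduleE(5)[OF sub] x by blast
  qed
  ultimately have "ideal_smult M (PIdl r) K \<subseteq> (\<lambda>y. r \<odot>\<^bsub>M\<^esub> y) ` K"
    unfolding ideal_smult_def by (rule M.add.generate_subgroup_incl)
  then show ?thesis using eq by simp
qed

text \<open>An element \<open>r\<close> outside the annihilator satisfies \<open>rK = K\<close>, so \<open>rK \<subseteq> Q\<close> would force \<open>K \<subseteq> Q\<close>.\<close>

lemma colon_second_submodule:
  assumes sec: "second_submodule R M K" and Q: "submodule Q R M" and "\<not> K \<subseteq> Q"
  shows "colon R M Q K = annihilator R M K"
proof
  show "colon R M Q K \<subseteq> annihilator R M K"
    using second_submodule_smult_surj[OF sec] assms(3) unfolding colon_def by blast
  show "annihilator R M K \<subseteq> colon R M Q K"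
    using zero_in_submodule[OF Q]
    unfolding annihilator_def colon_def by auto
qed

text \<open>The summands inside \<open>Q\<close> impose no condition on \<open>r\<close>; each of the others imposes \<open>r K\<^sub>i = 0\<close>.\<close>

lemma colon_carrier_second_representation:
  assumes rep: "second_representation R M n K" and Q: "submodule Q R M"
  shows "colon R M Q (carrier M) =
    carrier R \<inter> (\<Inter>i\<in>{i\<in>{1..n}. \<not> K i \<subseteq> Q}. annihilator R M (K i))"
proof -
  have sec: "second_submodule R M (K i)" if "i \<in> {1..n}" for i
    using rep that unfolding second_representation_def by blast
  have sub: "submodule (K i) R M" if "i \<in> {1..n}" for i
    using sec[OF that] unfolding second_submodule_def by blast
  have "colon R M Q (K i) = carrier R" if "K i \<subseteq> Q" for i
    using that submoduleE(4)[OF Q] unfolding colon_def by blast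
  moreover have "colon R M Q (K i) = annihilator R M (K i)" if "i \<in> {1..n}" "\<not> K i \<subseteq> Q" for i
    using colon_second_submodule[OF sec[OF that(1)] Q that(2)] .
  ultimately have "carrier R \<inter> (\<Inter>i\<in>{1..n}. colon R M Q (K i)) =
      carrier R \<inter> (\<Inter>i\<in>{i\<in>{1..n}. \<not> K i \<subseteq> Q}. annihilator R M (K i))"
    by blast
  moreover have "carrier M = submodule_sum M {1..n} K"
    using rep unfolding second_representation_def by blast
  ultimately show ?thesis
    using colon_submodule_sum[of "{1..n}" K Q] sub Q by simp
qed

section \<open>Uniqueness of the annihilators\<close>

text \<open>
  The submodule \<open>Q = \<Sum>\<^sub>l\<^sub>\<noteq>\<^sub>j N\<^sub>l\<close> isolates the annihilator of \<open>N\<^sub>j\<close> as a colon ideal \<open>(Q : M)\<close>,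
  which the representation \<open>K\<close> then writes as a finite intersection of annihilators.
\<close>

lemma annihilator_in_second_representation:
  assumes K: "second_representation R M n K"
    and N: "minimal_second_representation R M m N" and j: "j \<in> {1..m}"
  shows "\<exists>i\<in>{1..n}. annihilator R M (K i) = annihilator R M (N j)"
proof -
  define Q where "Q = submodule_sum M ({1..m} - {j}) N"
  have Nrep: "second_representation R M m N" and Nj: "\<not> N j \<subseteq> Q"
    using N j unfolding minimal_second_representation_def Q_def by auto
  have Nsub: "submodule (N l) R M" if "l \<in> {1..m}" for l
    using Nrep that unfolding second_representation_def second_submodule_def by blast
  have Ksub: "submodule (K i) R M" if "i \<in> {1..n}" for i
    using K that unfolding second_representation_def second_submodule_def by blast
  have Q: "submodule Q R M"
    unfolding Q_def using Nsub by (intro submodule_submodule_sum) auto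
  have "N l \<subseteq> Q" if "l \<in> {1..m}" "l \<noteq> j" for l
    unfolding Q_def using Nsub that by (intro summand_subset_submodule_sum) auto
  then have "{l \<in> {1..m}. \<not> N l \<subseteq> Q} = {j}" using j Nj by auto
  then have "colon R M Q (carrier M) = annihilator R M (N j)"
    using colon_carrier_second_representation[OF Nrep Q] by (auto simp: annihilator_def)
  then have eq: "annihilator R M (N j) =
      carrier R \<inter> (\<Inter>i\<in>{i\<in>{1..n}. \<not> K i \<subseteq> Q}. annihilator R M (K i))"
    using colon_carrier_second_representation[OF K Q] by simp
  have "p_second R M (annihilator R M (N j)) (N j)"
    using Nrep j unfolding second_representation_def p_second_def by blast
  then interpret P: primeideal "annihilator R M (N j)" R
    by (rule p_second_imp_primeideal)
  have "\<exists>i\<in>{i\<in>{1..n}. \<not> K i \<subseteq> Q}. annihilator R M (K i) \<subseteq> annihilator R M (N j)"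
  proof (rule P.finite_Inter_subset_imp_subset)
    show "ideal (annihilator R M (K i)) R" if "i \<in> {i\<in>{1..n}. \<not> K i \<subseteq> Q}" for i
      using annihilator_ideal[OF Ksub] that by blast
  qed (use eq in auto)
  with eq show ?thesis by blast
qed

end

theorem theorem2p9:
  fixes R :: "('a, 'r) ring_scheme" and M :: "('a, 'b, 'm) module_scheme"
    and n m :: nat and K N :: "nat \<Rightarrow> 'b set" and p q :: "nat \<Rightarrow> 'a set"
  assumes "module R M"
    and "carrier M \<noteq> {\<zero>\<^bsub>M\<^esub>}"
    and "minimal_second_representation R M n K"
    and "minimal_second_representation R M m N"
    and "\<And>i. i \<in> {1..n} \<Longrightarrow> p_second R M (p i) (K i)"
    and "\<And>j. j \<in> {1..m} \<Longrightarrow> p_second R M (q j) (N j)"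
  shows "p ` {1..n} = q ` {1..m}"
proof -
  interpret module R M by fact
  have p: "p i = annihilator R M (K i)" if "i \<in> {1..n}" for i
    using assms(5)[OF that] unfolding p_second_def by blast
  have q: "q j = annihilator R M (N j)" if "j \<in> {1..m}" for j
    using assms(6)[OF that] unfolding p_second_def by blast
  have rep: "second_representation R M n K" "second_representation R M m N"
    using assms(3,4) unfolding minimal_second_representation_def by blast+
  show ?thesis
  proof (intro equalityI subsetI)
    fix I assume "I \<in> p ` {1..n}"
    then obtain i where i: "i \<in> {1..n}" "I = annihilator R M (K i)" using p by auto
    with annihilator_in_second_representation[OF rep(2) assms(3) i(1)] q
    show "I \<in> q ` {1..m}" by (metis imageI)
  next
    fix I assume "I \<in> q ` {1..m}"
    then obtain j where j: "j \<in> {1..m}" "I = annihilator R M (N j)" using q by auto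
    with annihilator_in_second_representation[OF rep(1) assms(4) j(1)] p
    show "I \<in> p ` {1..n}" by (metis imageI)
  qed
qed

end
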